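(* Let $(\Omega,\mathcal{F})$ be a measurable space, let $\mathcal{P}=\{P_\theta;\ \theta\in\Theta\}$ be a family of probability measures on $(\Omega,\mathcal{F})$ indexed by an arbitrary set $\Theta$, and let $\nu_1,\nu_2$ be $\sigma$-finite measures on $(\Omega,\mathcal{F})$. Suppose that $\mathcal{P}\ll\nu_1$, $\mathcal{P}\ll\nu_2$, and that $\nu$ is a minimal dominating measure for $\mathcal{P}$. Then there exist a set $A\in\mathcal{F}$ with $P_\theta(A)=1$ for all $\theta\in\Theta$, functions $f_{1,\theta}\in\left[\frac{dP_\theta}{d\nu_1}\right]_\nu$ and $f_{2,\theta}\in\left[\frac{dP_\theta}{d\nu_2}\right]_\nu$ for every $\theta\in\Theta$, and a measurable function $h:\Omega\to\mathbb{R}$ (not depending on $\theta$) such that $$f_{1,\theta}(\omega)=h(\omega)f_{2,\theta}(\omega)\qquad\text{for all }\theta\in\Theta\text{ and all }\omega\in A.$$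
   Context: $\mathcal{P}\ll\nu$ means $P_\theta\ll\nu$ (absolute continuity) for every $\theta\in\Theta$. Let $\Upsilon$ be the collection of all $\sigma$-finite measures $\nu$ on $(\Omega,\mathcal{F})$ with $\mathcal{P}\ll\nu$. A minimal dominating measure for $\mathcal{P}$ is a $\lambda\in\Upsilon$ such that $\lambda\ll\nu$ for every $\nu\in\Upsilon$. $M(\Omega,\mathcal{F})$ is the set of measurable functions $\Omega\to\mathbb{R}$. For $f\in M(\Omega,\mathcal{F})$ and a measure $\mu$, $[f]_\mu$ is the set of all $g\in M(\Omega,\mathcal{F})$ with $g=f$ $\mu$-almost everywhere. Thus $\left[\frac{dP_\theta}{d\nu_i}\right]_\nu$ is the set of measurable functions equal $\nu$-a.e. to the Radon-Nikodým derivative of $P_\theta$ with respect to $\nu_i$ (well defined since $\nu\ll\nu_i$). *)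

theory Defs
  imports "HOL-Probability.Probability_Measure"
begin

text \<open>
  A measurable space is represented by a measure \<open>M\<close> of which only \<open>space M\<close> and \<open>sets M\<close> matter;
  a measure \<open>\<mu>\<close> on it is one with \<open>sets \<mu> = sets M\<close> (which forces \<open>space \<mu> = space M\<close>).
  In the library, \<open>absolutely_continuous \<nu> Q\<close> means that \<open>Q\<close> is absolutely continuous with
  respect to \<open>\<nu>\<close>: the dominating measure comes first.
\<close>

definition family_dominated :: "'t set \<Rightarrow> ('t \<Rightarrow> 'a measure) \<Rightarrow> 'a measure \<Rightarrow> bool" where
  "family_dominated \<Theta> P \<nu> \<longleftrightarrow> (\<forall>\<theta>\<in>\<Theta>. absolutely_continuous \<nu> (P \<theta>))"

definition dominating_measures ::
    "'a measure \<Rightarrow> 't set \<Rightarrow> ('t \<Rightarrow> 'a measure) \<Rightarrow> 'a measure set" where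
  "dominating_measures M \<Theta> P =
     {\<nu>. sets \<nu> = sets M \<and> sigma_finite_measure \<nu> \<and> family_dominated \<Theta> P \<nu>}"

definition minimal_dominating_measure ::
    "'a measure \<Rightarrow> 't set \<Rightarrow> ('t \<Rightarrow> 'a measure) \<Rightarrow> 'a measure \<Rightarrow> bool" where
  "minimal_dominating_measure M \<Theta> P \<kappa> \<longleftrightarrow>
     \<kappa> \<in> dominating_measures M \<Theta> P \<and>
     (\<forall>\<nu>\<in>dominating_measures M \<Theta> P. absolutely_continuous \<nu> \<kappa>)"

definition ae_class :: "'a measure \<Rightarrow> 'a measure \<Rightarrow> ('a \<Rightarrow> real) \<Rightarrow> ('a \<Rightarrow> real) set" where
  "ae_class M \<mu> f = {g \<in> borel_measurable M. AE \<omega> in \<mu>. g \<omega> = f \<omega>}"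

text \<open>
  The library's \<open>RN_deriv\<close> takes values in \<open>ennreal\<close>. For a finite \<open>Q\<close> dominated by a sigma-finite
  \<open>\<nu>\<close> it is finite \<open>\<nu>\<close>-almost everywhere, so passing to real values changes it only on a null set.
\<close>

definition real_RN_deriv :: "'a measure \<Rightarrow> 'a measure \<Rightarrow> 'a \<Rightarrow> real" where
  "real_RN_deriv \<nu> Q = (\<lambda>\<omega>. enn2real (RN_deriv \<nu> Q \<omega>))"

end

theory Submission imports Defs begin

text \<open>
  By the chain rule \<open>dP\<^sub>\<theta>/d\<nu>\<^sub>i = d\<nu>/d\<nu>\<^sub>i \<cdot> dP\<^sub>\<theta>/d\<nu>\<close> holds \<open>\<nu>\<close>-almost everywhere, and
  \<open>d\<nu>/d\<nu>\<^sub>i\<close> is positive and finite \<open>\<nu>\<close>-almost everywhere, so the quotient \<open>h\<close> of the densities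
  of \<open>\<nu>\<close> serves all \<open>\<theta>\<close> at once. Since members of an \<open>\<nu>\<close>-class may be altered on \<open>\<nu>\<close>-null sets,
  \<open>f\<^sub>1 = h f\<^sub>2\<close> can be imposed everywhere, and \<open>A\<close> can be taken to be the whole space.
\<close>

text \<open>Composing densities shows that the product is also a density of \<open>Q\<close> with
  respect to \<open>\<mu>\<close>; uniqueness gives equality \<open>\<mu>\<close>-a.e., and
  \<open>ac(1)\<close> carries it over to \<open>\<nu>\<close>.\<close>

lemma real_RN_deriv_chain:
  fixes \<mu> \<nu> Q :: "'a measure"
  assumes \<mu>: "sigma_finite_measure \<mu>" and \<nu>: "sigma_finite_measure \<nu>"
    and sets: "sets \<nu> = sets \<mu>" "sets Q = sets \<mu>"
    and ac: "absolutely_continuous \<mu> \<nu>" "absolutely_continuous \<nu> Q"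
  shows "AE \<omega> in \<nu>. real_RN_deriv \<mu> Q \<omega> = real_RN_deriv \<mu> \<nu> \<omega> * real_RN_deriv \<nu> Q \<omega>"
proof -
  interpret \<mu>: sigma_finite_measure \<mu> by fact
  interpret \<nu>: sigma_finite_measure \<nu> by fact
  have d\<nu>: "density \<mu> (RN_deriv \<mu> \<nu>) = \<nu>"
    by (rule \<mu>.density_RN_deriv) (use ac sets in auto)
  have dQ: "density \<nu> (RN_deriv \<nu> Q) = Q"
    by (rule \<nu>.density_RN_deriv) (use ac sets in auto)
  have [measurable]: "RN_deriv \<nu> Q \<in> borel_measurable \<mu>"
    using borel_measurable_RN_deriv[of \<nu> Q] measurable_cong_sets[OF sets(1) refl] by blast
  have "density \<mu> (\<lambda>\<omega>. RN_deriv \<mu> \<nu> \<omega> * RN_deriv \<nu> Q \<omega>)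
      = density (density \<mu> (RN_deriv \<mu> \<nu>)) (RN_deriv \<nu> Q)"
    by (rule density_density_eq[symmetric]) auto
  also have "\<dots> = Q"
    by (simp add: d\<nu> dQ)
  finally have "AE \<omega> in \<mu>. RN_deriv \<mu> \<nu> \<omega> * RN_deriv \<nu> Q \<omega> = RN_deriv \<mu> Q \<omega>"
    by (intro \<mu>.RN_deriv_unique) auto
  then have "AE \<omega> in \<nu>. RN_deriv \<mu> \<nu> \<omega> * RN_deriv \<nu> Q \<omega> = RN_deriv \<mu> Q \<omega>"
    by (rule absolutely_continuous_AE[OF sets(1) ac(1)])
  then show ?thesis
    \<comment> \<open>\<open>enn2real\<close> is multiplicative on all of \<open>ennreal\<close>,
      infinity being sent to 0, so the identity passes to real values pointwise.\<close>
    by (rule AE_mp) (auto intro!: AE_I2 simp: real_RN_deriv_def enn2real_mult[symmetric])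
qed

text \<open>A measure gives no mass to the zero set of its own density. This is what permits
  division by the density later.\<close>

lemma AE_real_RN_deriv_pos:
  fixes \<mu> \<nu> :: "'a measure"
  assumes \<mu>: "sigma_finite_measure \<mu>" and \<nu>: "sigma_finite_measure \<nu>"
    and sets: "sets \<nu> = sets \<mu>" and ac: "absolutely_continuous \<mu> \<nu>"
  shows "AE \<omega> in \<nu>. 0 < real_RN_deriv \<mu> \<nu> \<omega>"
proof -
  interpret \<mu>: sigma_finite_measure \<mu> by fact
  have "AE \<omega> in density \<mu> (RN_deriv \<mu> \<nu>). 0 < RN_deriv \<mu> \<nu> \<omega>"
    by (subst AE_density) auto
  then have pos: "AE \<omega> in \<nu>. 0 < RN_deriv \<mu> \<nu> \<omega>"
    unfolding \<mu>.density_RN_deriv[OF ac sets] .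
  \<comment> \<open>Since \<open>enn2real\<close> sends infinity to 0, positivity of the real
    version also requires finiteness, which comes from sigma-finiteness of
    \<open>\<nu>\<close>.\<close>
  have "AE \<omega> in \<nu>. RN_deriv \<mu> \<nu> \<omega> \<noteq> \<infinity>"
    by (rule absolutely_continuous_AE[OF sets ac \<mu>.RN_deriv_finite[OF \<nu> ac sets]])
  with pos show ?thesis
    by eventually_elim (auto simp: real_RN_deriv_def enn2real_positive_iff less_top)
qed

theorem theorem1:
  fixes M \<nu>\<^sub>1 \<nu>\<^sub>2 \<nu> :: "'a measure"
    and \<Theta> :: "'t set"
    and P :: "'t \<Rightarrow> 'a measure"
  assumes "\<And>\<theta>. \<theta> \<in> \<Theta> \<Longrightarrow> prob_space (P \<theta>)"
    and "\<And>\<theta>. \<theta> \<in> \<Theta> \<Longrightarrow> sets (P \<theta>) = sets M"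
    and "sigma_finite_measure \<nu>\<^sub>1" and "sets \<nu>\<^sub>1 = sets M"
    and "sigma_finite_measure \<nu>\<^sub>2" and "sets \<nu>\<^sub>2 = sets M"
    and "family_dominated \<Theta> P \<nu>\<^sub>1"
    and "family_dominated \<Theta> P \<nu>\<^sub>2"
    and "minimal_dominating_measure M \<Theta> P \<nu>"
  shows "\<exists>A f\<^sub>1 f\<^sub>2 h.
    A \<in> sets M \<and> (\<forall>\<theta>\<in>\<Theta>. measure (P \<theta>) A = 1) \<and>
    (\<forall>\<theta>\<in>\<Theta>. f\<^sub>1 \<theta> \<in> ae_class M \<nu> (real_RN_deriv \<nu>\<^sub>1 (P \<theta>))) \<and>
    (\<forall>\<theta>\<in>\<Theta>. f\<^sub>2 \<theta> \<in> ae_class M \<nu> (real_RN_deriv \<nu>\<^sub>2 (P \<theta>))) \<and>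
    h \<in> borel_measurable M \<and>
    (\<forall>\<theta>\<in>\<Theta>. \<forall>\<omega>\<in>A. f\<^sub>1 \<theta> \<omega> = h \<omega> * f\<^sub>2 \<theta> \<omega>)"
proof -
  have dom: "sets \<nu> = sets M" "sigma_finite_measure \<nu>"
    and acP: "\<And>\<theta>. \<theta> \<in> \<Theta> \<Longrightarrow> absolutely_continuous \<nu> (P \<theta>)"
    and minimal: "\<And>\<mu>. \<mu> \<in> dominating_measures M \<Theta> P \<Longrightarrow> absolutely_continuous \<mu> \<nu>"
    using assms(9)
    by (auto simp: minimal_dominating_measure_def dominating_measures_def family_dominated_def)
  \<comment> \<open>Minimality enters here: both \<open>\<nu>\<^sub>1\<close> and
    \<open>\<nu>\<^sub>2\<close> are themselves dominating measures.\<close>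
  have ac: "absolutely_continuous \<nu>\<^sub>1 \<nu>" "absolutely_continuous \<nu>\<^sub>2 \<nu>"
    using assms by (auto intro!: minimal simp: dominating_measures_def)
  have meas: "real_RN_deriv \<mu> Q \<in> borel_measurable M" if "sets \<mu> = sets M" for \<mu> Q
  proof -
    have "real_RN_deriv \<mu> Q \<in> borel_measurable \<mu>"
      unfolding real_RN_deriv_def by measurable
    then show ?thesis
      using measurable_cong_sets[OF that refl] by blast
  qed
  \<comment> \<open>Where the denominator vanishes, division by zero yields 0, so \<open>h\<close>
    is total and measurable; that set is \<open>\<nu>\<close>-null.\<close>
  define h where "h = (\<lambda>\<omega>. real_RN_deriv \<nu>\<^sub>1 \<nu> \<omega> / real_RN_deriv \<nu>\<^sub>2 \<nu> \<omega>)"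
  define f where "f = (\<lambda>\<theta>. real_RN_deriv \<nu>\<^sub>2 (P \<theta>))"
  have h: "h \<in> borel_measurable M"
    unfolding h_def by (intro borel_measurable_divide meas assms)
  have f: "f \<theta> \<in> borel_measurable M" for \<theta>
    unfolding f_def by (intro meas assms)
  \<comment> \<open>Apply the chain rule through \<open>\<nu>\<close> to both derivatives and cancel
    \<open>real_RN_deriv \<nu>\<^sub>2 \<nu>\<close>. The exceptional set may depend on
    \<open>\<theta>\<close>, which is harmless because class membership is checked for each
    \<open>\<theta>\<close> separately.\<close>
  have "AE \<omega> in \<nu>. h \<omega> * f \<theta> \<omega> = real_RN_deriv \<nu>\<^sub>1 (P \<theta>) \<omega>" if \<theta>: "\<theta> \<in> \<Theta>" for \<theta>
  proof -
    have "AE \<omega> in \<nu>. real_RN_deriv \<nu>\<^sub>1 (P \<theta>) \<omega> = real_RN_deriv \<nu>\<^sub>1 \<nu> \<omega> * real_RN_deriv \<nu> (P \<theta>) \<omega>"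
      by (rule real_RN_deriv_chain) (use assms dom ac acP \<theta> in auto)
    moreover have "AE \<omega> in \<nu>. f \<theta> \<omega> = real_RN_deriv \<nu>\<^sub>2 \<nu> \<omega> * real_RN_deriv \<nu> (P \<theta>) \<omega>"
      unfolding f_def by (rule real_RN_deriv_chain) (use assms dom ac acP \<theta> in auto)
    moreover have "AE \<omega> in \<nu>. 0 < real_RN_deriv \<nu>\<^sub>2 \<nu> \<omega>"
      by (rule AE_real_RN_deriv_pos) (use assms dom ac in auto)
    ultimately show ?thesis
      by eventually_elim (simp add: h_def)
  qed
  then have f1: "(\<lambda>\<omega>. h \<omega> * f \<theta> \<omega>) \<in> ae_class M \<nu> (real_RN_deriv \<nu>\<^sub>1 (P \<theta>))" if "\<theta> \<in> \<Theta>" for \<theta>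
    using that h f by (simp add: ae_class_def)
  have f2: "f \<theta> \<in> ae_class M \<nu> (real_RN_deriv \<nu>\<^sub>2 (P \<theta>))" for \<theta>
    using f by (simp add: ae_class_def f_def)
  have "measure (P \<theta>) (space M) = 1" if "\<theta> \<in> \<Theta>" for \<theta>
    using prob_space.prob_space[OF assms(1)[OF that]] sets_eq_imp_space_eq[OF assms(2)[OF that]]
    by simp
  then show ?thesis
    by (intro exI[of _ "space M"] exI[of _ "\<lambda>\<theta> \<omega>. h \<omega> * f \<theta> \<omega>"] exI[of _ f] exI[of _ h])
      (simp add: f1 f2 h)
qed

end
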